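(* Let $d\ge 1$, $\Omega=(-\pi,\pi)^d$ with periodic boundary conditions, and let $\lambda\in[0,1]$. Consider the Lawson--Euler scheme with time step size $\tau>0$ $$u^{n+1}=\mathrm{e}^{\tau\lambda\Delta}\bigl(u^{n}+\tau(1-\lambda)\Delta u^{n}\bigr)$$ for the heat equation $\partial_t u=\lambda\Delta u+(1-\lambda)\Delta u$ on $\Omega$. If $\lambda\ge 0.218$, then this scheme is unconditionally stable.
   Context: Functions of $\Delta$ act on periodic functions as Fourier multipliers, $\Delta$ acting on the $\boldsymbol k$-th Fourier mode ($\boldsymbol k\in\mathbb{Z}^d$) as multiplication by $-k^2$, where $k^2=\sum_{\mu=1}^d k_\mu^2$. The scheme therefore acts on each Fourier coefficient $\hat u^n_{\boldsymbol k}$ of $u^n$ by $\hat u^{n+1}_{\boldsymbol k}=\Phi(z,\lambda)\,\hat u^n_{\boldsymbol k}$ with $z=-\tau k^2$, where the stability function $\Phi(z,\lambda)$ is the scalar amplification factor obtained by formally replacing every occurrence of $\tau\Delta$ in the scheme by the real number $z$. The scheme (with parameter $\lambda$) is called unconditionally stable if $|\Phi(z,\lambda)|\le 1$ for all $z\in(-\infty,0]$. *)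

theory Defs
  imports "HOL-Analysis.Analysis"
begin

text \<open>The torus: \<open>\<Omega> = (-\<pi>, \<pi>)\<^sup>d\<close> with \<open>d = CARD('d)\<close>. Functions on it are functions on
  \<open>\<real>\<^sup>d\<close> that are \<open>2\<pi>\<close>-periodic in each coordinate; integrability over \<open>\<Omega>\<close> is what makes all
  Fourier coefficients meaningful. Complex values include the real-valued case.\<close>

definition Omega :: "(real ^ 'd::finite) set" where
  "Omega = {x. \<forall>\<mu>. - pi < x $ \<mu> \<and> x $ \<mu> < pi}"

definition periodic_fun :: "(real ^ 'd::finite \<Rightarrow> complex) \<Rightarrow> bool" where
  "periodic_fun u \<longleftrightarrow>
     (\<forall>x \<mu>. u (x + (2 * pi) *\<^sub>R axis \<mu> 1) = u x) \<and> set_integrable lborel Omega u"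

definition fourier_coeff :: "(real ^ 'd::finite \<Rightarrow> complex) \<Rightarrow> int ^ 'd \<Rightarrow> complex" where
  "fourier_coeff u k =
     (LINT x:Omega|lborel. u x * cis (- (\<Sum>\<mu>\<in>UNIV. of_int (k $ \<mu>) * x $ \<mu>)))
       / of_real ((2 * pi) ^ CARD('d))"

definition mode_sq :: "int ^ 'd::finite \<Rightarrow> real" where
  "mode_sq k = (\<Sum>\<mu>\<in>UNIV. (of_int (k $ \<mu>))\<^sup>2)"

text \<open>\<open>fourier_multiplier m u v\<close> says that \<open>v\<close> is the image of \<open>u\<close> under the multiplier \<open>m\<close>.
  It is a relation because \<open>u\<close> need not lie in the domain of the (possibly unbounded) operator
  and because \<open>v\<close> is determined by its Fourier coefficients only almost everywhere.\<close>

definition fourier_multiplier ::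
  "(int ^ 'd::finite \<Rightarrow> real) \<Rightarrow> (real ^ 'd \<Rightarrow> complex) \<Rightarrow> (real ^ 'd \<Rightarrow> complex) \<Rightarrow> bool" where
  "fourier_multiplier m u v \<longleftrightarrow> periodic_fun u \<and> periodic_fun v \<and>
     (\<forall>k. fourier_coeff v k = of_real (m k) * fourier_coeff u k)"

text \<open>A one-step scheme is kept as a formal expression in \<open>\<tau>\<Delta>\<close> (the symbol \<open>TauLap\<close>), so that
  replacing every occurrence of \<open>\<tau>\<Delta>\<close> by a real number is an operation on schemes.\<close>

datatype lap_expr =
    Ident
  | TauLap
  | Scale real lap_expr
  | Add lap_expr lap_expr
  | Comp lap_expr lap_expr
  | Exp lap_expr

primrec stability_function :: "lap_expr \<Rightarrow> real \<Rightarrow> real" where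
  "stability_function Ident z = 1"
| "stability_function TauLap z = z"
| "stability_function (Scale c A) z = c * stability_function A z"
| "stability_function (Add A B) z = stability_function A z + stability_function B z"
| "stability_function (Comp A B) z = stability_function A z * stability_function B z"
| "stability_function (Exp A) z = exp (stability_function A z)"

text \<open>\<open>acts \<tau> A u v\<close>: applying the operator denoted by \<open>A\<close>, for time step size \<open>\<tau>\<close>, to the
  periodic function \<open>u\<close> gives \<open>v\<close>.\<close>

primrec acts ::
  "real \<Rightarrow> lap_expr \<Rightarrow> (real ^ 'd::finite \<Rightarrow> complex) \<Rightarrow> (real ^ 'd \<Rightarrow> complex) \<Rightarrow> bool" where
  "acts \<tau> Ident u v \<longleftrightarrow> periodic_fun u \<and> v = u"
| "acts \<tau> TauLap u v \<longleftrightarrow> fourier_multiplier (\<lambda>k. \<tau> * (- mode_sq k)) u v"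
| "acts \<tau> (Scale c A) u v \<longleftrightarrow> (\<exists>w. acts \<tau> A u w \<and> v = (\<lambda>x. of_real c * w x))"
| "acts \<tau> (Add A B) u v \<longleftrightarrow>
     (\<exists>w w'. acts \<tau> A u w \<and> acts \<tau> B u w' \<and> v = (\<lambda>x. w x + w' x))"
| "acts \<tau> (Comp A B) u v \<longleftrightarrow> (\<exists>w. acts \<tau> B u w \<and> acts \<tau> A w v)"
| "acts \<tau> (Exp A) u v \<longleftrightarrow>
     fourier_multiplier (\<lambda>k. exp (stability_function A (- \<tau> * mode_sq k))) u v"

definition unconditionally_stable :: "lap_expr \<Rightarrow> bool" where
  "unconditionally_stable S \<longleftrightarrow> (\<forall>z\<le>0. \<bar>stability_function S z\<bar> \<le> 1)"

text \<open>The right-hand side of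
  \<open>u\<^sup>n\<^sup>+\<^sup>1 = exp (\<tau>\<lambda>\<Delta>) (u\<^sup>n + \<tau>(1 - \<lambda>)\<Delta>u\<^sup>n)\<close>.\<close>

definition lawson_euler :: "real \<Rightarrow> lap_expr" where
  "lawson_euler lam = Comp (Exp (Scale lam TauLap)) (Add Ident (Scale (1 - lam) TauLap))"

definition scheme_solution ::
  "real \<Rightarrow> lap_expr \<Rightarrow> (nat \<Rightarrow> real ^ 'd::finite \<Rightarrow> complex) \<Rightarrow> bool" where
  "scheme_solution \<tau> S u \<longleftrightarrow> (\<forall>n. acts \<tau> S (u n) (u (Suc n)))"

lemma acts_lawson_euler_iff:
  "acts \<tau> (lawson_euler lam) u v \<longleftrightarrow>
     (\<exists>w. fourier_multiplier (\<lambda>k. \<tau> * (- mode_sq k)) u w \<and>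
          fourier_multiplier (\<lambda>k. exp (lam * (- \<tau> * mode_sq k)))
            (\<lambda>x. u x + of_real (1 - lam) * w x) v)"
  by (auto simp: lawson_euler_def fourier_multiplier_def)

lemma stability_function_lawson_euler:
  "stability_function (lawson_euler lam) z = exp (lam * z) * (1 + (1 - lam) * z)"
  by (simp add: lawson_euler_def)

end

theory Submission imports Defs begin

text \<open>
  Linearity of the Fourier coefficients turns the scheme into multiplication by
  \<open>\<Phi>(z) = exp (\<lambda>z) (1 + (1 - \<lambda>)z)\<close> on every mode. From \<open>1 + (1 - \<lambda>)z \<le> exp ((1 - \<lambda>)z)\<close> one gets
  \<open>\<Phi>(z) \<le> exp z \<le> 1\<close>. With \<open>y = -z\<close>, the bound \<open>\<Phi>(z) \<ge> -1\<close> reads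
  \<open>(1 - \<lambda>)y - 1 \<le> exp (\<lambda>y)\<close>. The left side decreases and the right side increases in \<open>\<lambda>\<close>, so only
  \<open>\<lambda> = 0.218\<close> matters, and there the line on the left lies below a tangent of the exponential.
\<close>

text \<open>The exponential factor is continuous of modulus 1, so \<open>u\<close> itself dominates
  the product.\<close>

lemma integrable_fourier_integrand:
  fixes u :: "real ^ 'd::finite \<Rightarrow> complex" and k :: "int ^ 'd"
  assumes "periodic_fun u"
  shows "set_integrable lborel Omega
           (\<lambda>x. u x * cis (- (\<Sum>\<mu>\<in>UNIV. of_int (k $ \<mu>) * x $ \<mu>)))"
proof -
  let ?e = "\<lambda>x::real^'d. cis (- (\<Sum>\<mu>\<in>UNIV. of_int (k $ \<mu>) * x $ \<mu>))"
  let ?f = "\<lambda>x. indicator Omega x *\<^sub>R u x"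
  have u: "integrable lborel ?f"
    using assms by (simp add: periodic_fun_def set_integrable_def)
  have "continuous_on UNIV ?e"
    unfolding cis_conv_exp by (intro continuous_intros)
  then have "?e \<in> borel_measurable lborel"
    by (simp add: borel_measurable_continuous_onI)
  with borel_measurable_integrable[OF u]
  have "(\<lambda>x. ?f x * ?e x) \<in> borel_measurable lborel"
    by (rule borel_measurable_times)
  then have "integrable lborel (\<lambda>x. ?f x * ?e x)"
    by (rule Bochner_Integration.integrable_bound[OF u]) (simp add: norm_mult)
  then show ?thesis
    by (simp add: set_integrable_def)
qed

lemma fourier_coeff_add_scale:
  fixes u w :: "real ^ 'd::finite \<Rightarrow> complex"
  assumes "periodic_fun u" "periodic_fun w"
  shows "fourier_coeff (\<lambda>x. u x + c * w x) k = fourier_coeff u k + c * fourier_coeff w k"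
proof -
  let ?e = "\<lambda>x::real^'d. cis (- (\<Sum>\<mu>\<in>UNIV. of_int (k $ \<mu>) * x $ \<mu>))"
  have "set_integrable lborel Omega (\<lambda>x. c * (w x * ?e x))"
    using integrable_fourier_integrand[OF assms(2)] by simp
  with integrable_fourier_integrand[OF assms(1)]
  have "(LINT x:Omega|lborel. u x * ?e x + c * (w x * ?e x)) =
        (LINT x:Omega|lborel. u x * ?e x) + c * (LINT x:Omega|lborel. w x * ?e x)"
    by (subst set_integral_add(2)) simp_all
  then show ?thesis
    by (simp add: fourier_coeff_def algebra_simps add_divide_distrib)
qed

lemma fourier_coeff_lawson_euler:
  assumes "acts \<tau> (lawson_euler lam) u v"
  shows "fourier_coeff v k =
    of_real (stability_function (lawson_euler lam) (- \<tau> * mode_sq k)) * fourier_coeff u k"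
proof -
  obtain w where w: "fourier_multiplier (\<lambda>k. \<tau> * (- mode_sq k)) u w"
    and v: "fourier_multiplier (\<lambda>k. exp (lam * (- \<tau> * mode_sq k)))
              (\<lambda>x. u x + of_real (1 - lam) * w x) v"
    using assms unfolding acts_lawson_euler_iff by blast
  have "fourier_coeff v k = of_real (exp (lam * (- \<tau> * mode_sq k))) *
          (fourier_coeff u k + of_real (1 - lam) * fourier_coeff w k)"
    using v w fourier_coeff_add_scale[of u w "of_real (1 - lam)" k]
    by (simp add: fourier_multiplier_def)
  moreover have "fourier_coeff w k = of_real (- \<tau> * mode_sq k) * fourier_coeff u k"
    using w by (simp add: fourier_multiplier_def)
  ultimately show ?thesis
    unfolding stability_function_lawson_euler
    by (simp only: of_real_mult of_real_add of_real_1 distrib_left distrib_right mult.assoc mult_1)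
qed

text \<open>All omitted terms are nonnegative. This gives a rational lower bound for
  \<open>exp 1.278\<close>.\<close>

lemma exp_ge_taylor_sum:
  fixes x :: real
  assumes "0 \<le> x"
  shows "(\<Sum>i<n. x ^ i / fact i) \<le> exp x"
proof -
  have s: "(\<lambda>i. x ^ i / fact i) sums exp x"
    using exp_converges[of x] by (simp add: divide_inverse mult.commute)
  show ?thesis
    using sum_le_suminf[OF sums_summable[OF s], of "{..<n}"] sums_unique[OF s] assms by simp
qed

text \<open>The slope is \<open>(1 - \<lambda>) / \<lambda>\<close> at \<open>\<lambda> = 0.218\<close>; the point of tangency \<open>1.278\<close> approximates its
  logarithm.\<close>

lemma line_le_exp:
  fixes x :: real
  assumes "0 \<le> x"
  shows "0.782 / 0.218 * x - 1 \<le> exp x"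
proof (cases "x < 0.278")
  \<comment> \<open>The tangent at 1.278 vanishes at 0.278. Below that the line is negative; above
    it both factors are nonnegative and the bounds multiply.\<close>
  case True
  then have "0.782 / 0.218 * x - 1 \<le> 0" by simp
  then show ?thesis using exp_ge_zero[of x] by linarith
next
  case False
  \<comment> \<open>The bound 3.588 slightly exceeds the slope 0.782 / 0.218 = 3.5871..., while
    3.588 * 0.278 stays below 1.\<close>
  have "3.588 \<le> exp (1.278::real)"
    using exp_ge_taylor_sum[of "1.278" 8]
    by (simp add: eval_nat_numeral fact_numeral lessThan_Suc)
  moreover have "x - 0.278 \<le> exp (x - 1.278)"
    using exp_ge_add_one_self[of "x - 1.278"] by simp
  ultimately have "3.588 * (x - 0.278) \<le> exp 1.278 * exp (x - 1.278)"
    using False by (intro mult_mono) auto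
  also have "\<dots> = exp x"
    by (simp flip: exp_add)
  finally show ?thesis using assms by simp
qed

lemma lawson_euler_unconditionally_stable:
  assumes "0.218 \<le> lam" "lam \<le> 1"
  shows "unconditionally_stable (lawson_euler lam)"
  unfolding unconditionally_stable_def stability_function_lawson_euler
proof (intro allI impI)
  fix z :: real
  assume z: "z \<le> 0"
  have "exp (lam * z) * (1 + (1 - lam) * z) \<le> exp (lam * z) * exp ((1 - lam) * z)"
    by (intro mult_left_mono exp_ge_add_one_self) auto
  also have "\<dots> = exp z"
    by (simp flip: exp_add add: algebra_simps)
  also have "\<dots> \<le> 1" using z by simp
  finally have upper: "exp (lam * z) * (1 + (1 - lam) * z) \<le> 1" .
  \<comment> \<open>This one inequality bounds both sides in \<open>lam\<close>; the tangent bound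
    is then used at \<open>x = - 0.218 * z\<close>.\<close>
  have mono: "lam * z \<le> 0.218 * z"
    using assms z by (intro mult_right_mono_neg) auto
  then have "- (1 + (1 - lam) * z) \<le> 0.782 / 0.218 * (- 0.218 * z) - 1"
    by (simp add: algebra_simps)
  also have "\<dots> \<le> exp (- 0.218 * z)"
    using z by (intro line_le_exp) simp
  also have "\<dots> \<le> exp (- (lam * z))" using mono by simp
  finally have "exp (lam * z) * (- (1 + (1 - lam) * z)) \<le> exp (lam * z) * exp (- (lam * z))"
    by (intro mult_left_mono) auto
  also have "\<dots> = 1"
    by (simp flip: exp_add)
  finally show "\<bar>exp (lam * z) * (1 + (1 - lam) * z)\<bar> \<le> 1"
    using upper by (simp only: abs_le_iff mult_minus_right simp_thms)
qed

theorem theorem2p2: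
  fixes lam \<tau> :: real
  assumes "0 \<le> lam" and "lam \<le> 1" and "\<tau> > 0"
    and "lam \<ge> 0.218"
  shows "(\<forall>u :: nat \<Rightarrow> real ^ 'd::finite \<Rightarrow> complex. scheme_solution \<tau> (lawson_euler lam) u \<longrightarrow>
            (\<forall>n k. fourier_coeff (u (Suc n)) k =
               of_real (stability_function (lawson_euler lam) (- \<tau> * mode_sq k)) * fourier_coeff (u n) k))
       \<and> unconditionally_stable (lawson_euler lam)"
  using fourier_coeff_lawson_euler lawson_euler_unconditionally_stable[of lam] assms
  unfolding scheme_solution_def by blast

end
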